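(* Let $n$ be a positive integer, $N=2^n$, let $F$ be a $\{0,1\}$-valued function on the $N$-element set $\mathbb{Z}_2^n$, and let $t=|\{e\in\mathbb{Z}_2^n : F(e)=1\}|$. Let $k_0,l_0\in\mathbb{C}$ satisfy $t|k_0|^2+(N-t)|l_0|^2=1$, and let $k_1,l_1$ be the amplitudes (given explicitly in the context) obtained after one application of the Grover operator $\mathbf{G}_{F,\beta,\gamma}$ of $(\beta,\gamma)$-phase to $|\psi(k_0,l_0)\rangle$, so that $\mathbf{G}_{F,\beta,\gamma}|\psi(k_0,l_0)\rangle=|\psi(k_1,l_1)\rangle$. Assume that $k_0=l_0$ and $\beta,\gamma\in[0,2\pi]$. Then $l_1=0$ if and only if $$\frac{N}{4}\le t\le N\qquad\text{and}\qquad \beta=\gamma=\cos^{-1}\left(1-\frac{N}{2t}\right).$$ In this case, $k_1=(e^{\imath\gamma}-1)k_0$.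
   Context: Here $\imath=\sqrt{-1}$. Let $\{|e\rangle\}_{e\in\mathbb{Z}_2^n}$ be the standard orthonormal basis of the $N$-dimensional complex Hilbert space $\mathcal{H}_N$, $N=2^n$. For $\gamma\in\mathbb{R}$, the conditional $\gamma$-phase transform $\mathbf{S}_{F,\gamma}:\mathcal{H}_N\to\mathcal{H}_N$ is the linear operator with $\mathbf{S}_{F,\gamma}|e\rangle=(e^{\imath\gamma})^{F(e)}|e\rangle$ for every basis vector $|e\rangle$. For $\beta\in\mathbb{R}$, the $\beta$-phase diffusion transform $\mathbf{D}_\beta:\mathcal{H}_N\to\mathcal{H}_N$ is $\mathbf{D}_\beta=I+(e^{\imath\beta}-1)P$, where $P$ is the $N\times N$ matrix all of whose entries in the standard basis equal $\frac1N$. The Grover operator of $(\beta,\gamma)$-phase is $\mathbf{G}_{F,\beta,\gamma}=\mathbf{D}_\beta\mathbf{S}_{F,\gamma}$. Let $A=\{e\in\mathbb{Z}_2^n: F(e)=1\}$, $B=\{e\in\mathbb{Z}_2^n: F(e)=0\}$, so $t=|A|$. For $k,l\in\mathbb{C}$ with $t|k|^2+(N-t)|l|^2=1$, put $$|\psi(k,l)\rangle=\sum_{e\in A}k|e\rangle+\sum_{e\in B}l|e\rangle .$$ The amplitudes $k_1,l_1$ with $\mathbf{G}_{F,\beta,\gamma}|\psi(k_0,l_0)\rangle=|\psi(k_1,l_1)\rangle$ are given by $$k_1=\frac{(e^{\imath\beta}-1)t+N}{N}e^{\imath\gamma}k_0+\frac{(e^{\imath\beta}-1)(N-t)}{N}l_0,$$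 $$l_1=\frac{(e^{\imath\beta}-1)t}{N}e^{\imath\gamma}k_0+\frac{(e^{\imath\beta}-1)(N-t)+N}{N}l_0.$$
   Formalization: The inverse cosine is read as any angle γ in [0,2π] with cos γ = 1 − N/(2t), not only the principal value; with the principal value the claim fails, e.g. t = N/2, β = γ = 3π/2 gives l_1 = 0. *)

theory Defs
  imports "HOL-Analysis.Analysis"
begin

text \<open>
  The numeral type \<open>2\<close> is the ring of integers modulo 2, so \<open>2 ^ 'n\<close> is the group
  \<open>Z_2^n\<close> with \<open>n = CARD('n) \<ge> 1\<close>, and vectors indexed by it form the Hilbert space of dimension
  \<open>N = 2 ^ CARD('n)\<close>.
\<close>

type_synonym 'n bitvec = "2 ^ 'n"
type_synonym 'n hilbert = "complex ^ 'n bitvec"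

definition ket :: "'n::finite bitvec \<Rightarrow> 'n hilbert" where
  "ket e = axis e 1"

definition phase_transform :: "('n::finite bitvec \<Rightarrow> nat) \<Rightarrow> real \<Rightarrow> 'n hilbert \<Rightarrow> 'n hilbert" where
  "phase_transform F \<gamma> v = (\<chi> e. exp (\<i> * of_real \<gamma>) ^ F e * v $ e)"

definition averaging_matrix :: "complex ^ 'n::finite bitvec ^ 'n bitvec" where
  "averaging_matrix = (\<chi> i j. 1 / of_nat (2 ^ CARD('n)))"

definition diffusion_transform :: "real \<Rightarrow> 'n::finite hilbert \<Rightarrow> 'n hilbert" where
  "diffusion_transform \<beta> v = v + (exp (\<i> * of_real \<beta>) - 1) *s (averaging_matrix *v v)"

definition grover_operator ::
  "('n::finite bitvec \<Rightarrow> nat) \<Rightarrow> real \<Rightarrow> real \<Rightarrow> 'n hilbert \<Rightarrow> 'n hilbert" where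
  "grover_operator F \<beta> \<gamma> = diffusion_transform \<beta> \<circ> phase_transform F \<gamma>"

definition grover_state ::
  "('n::finite bitvec \<Rightarrow> nat) \<Rightarrow> complex \<Rightarrow> complex \<Rightarrow> 'n hilbert" where
  "grover_state F k l = (\<Sum>e | F e = 1. k *s ket e) + (\<Sum>e | F e = 0. l *s ket e)"

text \<open>
  The coordinate formula for \<^const>\<open>phase_transform\<close> describes the linear operator that is
  determined by its values on the standard basis.
\<close>

lemma linear_phase_transform: "Vector_Spaces.linear (*s) (*s) (phase_transform F \<gamma>)"
  by unfold_locales (simp_all add: phase_transform_def vec_eq_iff algebra_simps)

lemma phase_transform_ket:
  "phase_transform F \<gamma> (ket e) = exp (\<i> * of_real \<gamma>) ^ F e *s ket e"
  by (rule vec_eq_iff[THEN iffD2]) (simp add: phase_transform_def ket_def axis_def)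

lemma card_bitvec: "CARD('n::finite bitvec) = 2 ^ CARD('n)"
  by simp

end

theory Submission
  imports Defs
begin

text \<open>
  Write \<open>b = exp (\<i> \<beta>)\<close>, \<open>g = exp (\<i> \<gamma>)\<close> and \<open>x = t / N\<close>. With \<open>k0 = l0\<close>, the equation
  \<open>l1 = 0\<close> reads \<open>x (1 - b) (1 - g) = - b\<close>. Conjugating it and using \<open>|b| = |g| = 1\<close> gives
  \<open>x (1 - b) (1 - g) = - g\<close>, so \<open>b = g\<close>; moreover \<open>b \<noteq> 1\<close>, which excludes the end points of
  \<open>[0, 2 \<pi>]\<close> and yields \<open>\<beta> = \<gamma>\<close>. Finally \<open>(1 - b)\<^sup>2 = - 2 (1 - cos \<beta>) b\<close> turns the equation
  into \<open>2 x (1 - cos \<beta>) = 1\<close>.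
\<close>

text \<open>Coordinates turn equality of states into a pointwise check. As \<open>F\<close> takes
  only the values 0 and 1, its two level sets are complementary, so each index lies in exactly one
  sum.\<close>

lemma grover_state_nth:
  fixes F :: "'n::finite bitvec \<Rightarrow> nat"
  assumes "\<forall>e. F e \<in> {0, 1}"
  shows "grover_state F k l $ e = (if F e = 1 then k else l)"
proof -
  have axis_sum: "(\<Sum>x\<in>S. c * axis x (1::complex) $ e) = (if e \<in> S then c else 0)"
    for S :: "'n bitvec set" and c
    by (simp add: axis_def if_distrib sum.delta cong: if_cong)
  show ?thesis
    using assms[rule_format, of e] by (auto simp: grover_state_def ket_def axis_sum)
qed

lemma sum_if_level_set:
  fixes F :: "'n::finite bitvec \<Rightarrow> nat" and c d :: complex
  shows "(\<Sum>e\<in>UNIV. if F e = 1 then c else d) =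
    of_nat (card {e. F e = 1}) * c + (2 ^ CARD('n) - of_nat (card {e. F e = 1})) * d"
proof -
  \<comment> \<open>This bound keeps the natural-number subtraction in the size of the complement
    from truncating.\<close>
  have "card {e. F e = 1} \<le> CARD('n bitvec)"
    by (rule card_mono) auto
  moreover have "card (- {e. F e = 1}) = CARD('n bitvec) - card {e. F e = 1}"
    unfolding Compl_eq_Diff_UNIV by (rule card_Diff_subset) auto
  ultimately show ?thesis
    by (simp add: sum.If_cases of_nat_diff Collect_neg_eq[symmetric])
qed

text \<open>The phase multiplies the amplitude on the marked set by \<open>g\<close>; diffusion then
  adds \<open>b - 1\<close> times the mean amplitude to every coordinate, so amplitudes stay
  constant on both level sets.\<close>

lemma grover_operator_grover_state:
  fixes F :: "'n::finite bitvec \<Rightarrow> nat" and \<beta> \<gamma> :: real and k l :: complex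
  defines "N \<equiv> 2 ^ CARD('n)" and "t \<equiv> of_nat (card {e. F e = 1})"
    and "b \<equiv> exp (\<i> * of_real \<beta>)" and "g \<equiv> exp (\<i> * of_real \<gamma>)"
  assumes F: "\<forall>e. F e \<in> {0, 1}"
  shows "grover_operator F \<beta> \<gamma> (grover_state F k l) =
    grover_state F (((b - 1) * t + N) / N * g * k + (b - 1) * (N - t) / N * l)
      ((b - 1) * t / N * g * k + ((b - 1) * (N - t) + N) / N * l)"
proof -
  let ?v = "phase_transform F \<gamma> (grover_state F k l)"
  have v: "?v $ e = (if F e = 1 then g * k else l)" for e
    using F[rule_format, of e] by (auto simp: phase_transform_def grover_state_nth[OF F] g_def)
  have "(averaging_matrix *v ?v) $ e = (\<Sum>e\<in>UNIV. ?v $ e) / N" for e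
    by (simp add: averaging_matrix_def matrix_vector_mult_def N_def sum_divide_distrib)
  then have avg: "(averaging_matrix *v ?v) $ e = (t * (g * k) + (N - t) * l) / N" for e
    unfolding v sum_if_level_set N_def t_def .
  have "N \<noteq> 0"
    by (simp add: N_def)
  then have k: "(g * k) + (b - 1) * ((t * (g * k) + (N - t) * l) / N) =
      ((b - 1) * t + N) / N * g * k + (b - 1) * (N - t) / N * l"
    and l: "l + (b - 1) * ((t * (g * k) + (N - t) * l) / N) =
      (b - 1) * t / N * g * k + ((b - 1) * (N - t) + N) / N * l"
    by (simp_all add: field_simps)
  show ?thesis
    unfolding vec_eq_iff grover_operator_def diffusion_transform_def comp_apply
      vector_add_component vector_smult_component v avg grover_state_nth[OF F] b_def[symmetric]
    by (simp only: k l split: if_split) simp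
qed

lemma unit_eq_of_phase_equation:
  fixes b g :: complex and x :: real
  assumes b: "cmod b = 1" and g: "cmod g = 1"
    and eq: "of_real x * (1 - b) * (1 - g) = - b"
  shows "b = g"
proof -
  have bb: "b * cnj b = 1" and gg: "g * cnj g = 1"
    using b g by (simp_all add: complex_norm_square[symmetric])
  have "cnj (of_real x * (1 - b) * (1 - g)) = cnj (- b)"
    using eq by simp
  then have "of_real x * (1 - cnj b) * (1 - cnj g) = - cnj b"
    by simp
  \<comment> \<open>Multiplying by \<open>b * g\<close> clears the conjugates, which are the
    inverses of \<open>b\<close> and \<open>g\<close>.\<close>
  then have "of_real x * ((1 - cnj b) * b) * ((1 - cnj g) * g) = - (b * cnj b) * g"
    by (simp add: ac_simps)
  moreover have "(1 - cnj b) * b = b - 1" "(1 - cnj g) * g = g - 1"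
    using bb gg by (simp_all add: algebra_simps)
  ultimately have "- g = of_real x * (b - 1) * (g - 1)"
    using bb by simp
  also have "\<dots> = - b"
    unfolding eq[symmetric] by (simp add: algebra_simps)
  finally show ?thesis
    by simp
qed

text \<open>The exponential is injective on imaginary parts less than \<open>2 * pi\<close> apart;
  only the identification of 0 with \<open>2 * pi\<close> could break this, and there its value is
  1.\<close>

lemma exp_ii_eq_imp_eq:
  fixes \<beta> \<gamma> :: real
  assumes "\<beta> \<in> {0..2 * pi}" and "\<gamma> \<in> {0..2 * pi}"
    and eq: "exp (\<i> * of_real \<beta>) = exp (\<i> * of_real \<gamma>)"
    and ne: "exp (\<i> * of_real \<beta>) \<noteq> 1"
  shows "\<beta> = \<gamma>"
proof -
  have end_points: "exp (\<i> * of_real \<theta>) = 1" if "\<theta> = 0 \<or> \<theta> = 2 * pi" for \<theta> :: real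
    using that exp_two_pi_i by (auto simp: mult_ac)
  have "\<beta> \<noteq> 2 * pi" "\<gamma> \<noteq> 2 * pi"
    using end_points[of \<beta>] end_points[of \<gamma>] eq ne by auto
  then have "\<bar>\<beta> - \<gamma>\<bar> < 2 * pi"
    using assms(1,2) by auto
  then show ?thesis
    using exp_complex_eqI[of "\<i> * of_real \<beta>" "\<i> * of_real \<gamma>"] eq by auto
qed

text \<open>With \<open>b\<close> the exponential,
  \<open>(1 - b)\<^sup>2 = b * (b + 1 / b - 2)\<close>, and \<open>b + 1 / b\<close> is twice the
  cosine.\<close>

lemma one_minus_exp_ii_squared:
  "(1 - exp (\<i> * of_real \<beta>))\<^sup>2 = - of_real (2 * (1 - cos \<beta>)) * exp (\<i> * of_real \<beta>)"
proof -
  have "exp (\<i> * of_real \<beta>) * exp (- (\<i> * of_real \<beta>)) = 1"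
    by (simp add: exp_minus)
  then show ?thesis
    by (simp add: cos_of_real[symmetric] cos_exp_eq power2_eq_square algebra_simps)
qed

lemma phase_equation_iff:
  fixes \<beta> \<gamma> x :: real
  defines "b \<equiv> exp (\<i> * of_real \<beta>)" and "g \<equiv> exp (\<i> * of_real \<gamma>)"
  assumes "\<beta> \<in> {0..2 * pi}" and "\<gamma> \<in> {0..2 * pi}"
  shows "of_real x * (1 - b) * (1 - g) = - b \<longleftrightarrow> \<beta> = \<gamma> \<and> 2 * x * (1 - cos \<gamma>) = 1"
proof -
  have b0: "b \<noteq> 0"
    by (simp add: b_def)
  \<comment> \<open>For equal phases both sides are multiples of \<open>b\<close>; cancelling it
    leaves a real equation.\<close>
  have same: "of_real x * (1 - b) * (1 - b) = - b \<longleftrightarrow> 2 * x * (1 - cos \<beta>) = 1"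
  proof -
    have "of_real x * (1 - b) * (1 - b) = - (of_real (2 * x * (1 - cos \<beta>)) * b)"
      unfolding mult.assoc power2_eq_square[symmetric] b_def one_minus_exp_ii_squared
      by (simp add: algebra_simps)
    then have "of_real x * (1 - b) * (1 - b) = - b \<longleftrightarrow> complex_of_real (2 * x * (1 - cos \<beta>)) = 1"
      using b0 by (simp del: of_real_mult of_real_diff)
    then show ?thesis
      by (simp only: of_real_eq_1_iff)
  qed
  show ?thesis
  proof
    assume eq: "of_real x * (1 - b) * (1 - g) = - b"
    have "b = g"
      by (rule unit_eq_of_phase_equation[OF _ _ eq]) (simp_all add: b_def g_def)
    moreover have "b \<noteq> 1"
      using eq by auto
    ultimately have "\<beta> = \<gamma>"
      using exp_ii_eq_imp_eq assms by blast
    then show "\<beta> = \<gamma> \<and> 2 * x * (1 - cos \<gamma>) = 1"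
      using eq same \<open>b = g\<close> by simp
  next
    assume "\<beta> = \<gamma> \<and> 2 * x * (1 - cos \<gamma>) = 1"
    then show "of_real x * (1 - b) * (1 - g) = - b"
      using same by (simp add: b_def g_def)
  qed
qed

text \<open>The inverse cosine is read as a preimage, because \<gamma> ranges over a full period and
  both \<gamma> and \<open>2 * pi - \<gamma>\<close> are solutions.\<close>

theorem theorem1:
  fixes F :: "'n::finite bitvec \<Rightarrow> nat"
    and n N t :: nat
    and \<beta> \<gamma> :: real
    and k0 l0 k1 l1 :: complex
  assumes "n = CARD('n)"
    and "N = 2 ^ n"
    and "\<forall>e. F e \<in> {0, 1}"
    and "t = card {e. F e = 1}"
    and "real t * (cmod k0)\<^sup>2 + (real N - real t) * (cmod l0)\<^sup>2 = 1"
    and "k1 = ((exp (\<i> * of_real \<beta>) - 1) * of_nat t + of_nat N) / of_nat N * exp (\<i> * of_real \<gamma>) * k0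
              + (exp (\<i> * of_real \<beta>) - 1) * (of_nat N - of_nat t) / of_nat N * l0"
    and "l1 = (exp (\<i> * of_real \<beta>) - 1) * of_nat t / of_nat N * exp (\<i> * of_real \<gamma>) * k0
              + ((exp (\<i> * of_real \<beta>) - 1) * (of_nat N - of_nat t) + of_nat N) / of_nat N * l0"
    and "k0 = l0"
    and "\<beta> \<in> {0..2 * pi}"
    and "\<gamma> \<in> {0..2 * pi}"
  shows "grover_operator F \<beta> \<gamma> (grover_state F k0 l0) = grover_state F k1 l1
    \<and> (l1 = 0 \<longleftrightarrow>
         real N / 4 \<le> real t \<and> t \<le> N
         \<and> \<beta> = \<gamma> \<and> \<gamma> \<in> cos -` {1 - real N / (2 * real t)})
    \<and> (l1 = 0 \<longrightarrow> k1 = (exp (\<i> * of_real \<gamma>) - 1) * k0)"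
proof -
  define b where "b = exp (\<i> * of_real \<beta>)"
  define g where "g = exp (\<i> * of_real \<gamma>)"
  define x where "x = real t / real N"
  note k1 = assms(6)[folded b_def g_def] and l1 = assms(7)[folded b_def g_def]
  have N: "real N > 0"
    using assms(2) by simp
  have "t \<le> CARD('n bitvec)"
    unfolding assms(4) by (rule card_mono) auto
  then have tN: "t \<le> N"
    using assms(1,2) by simp
  \<comment> \<open>Otherwise both amplitudes vanish, against normalisation.\<close>
  have k0: "k0 \<noteq> 0"
    using assms(5,8) by auto
  have xN: "of_nat t = of_real x * (of_nat N :: complex)"
    using N by (simp add: x_def)
  have "l1 = ((b - 1) * of_real x * g + ((b - 1) * (1 - of_real x) + 1)) * k0"
    using N unfolding l1 xN assms(8)[symmetric] by (simp add: field_simps)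
  then have "l1 = (of_real x * (1 - b) * (1 - g) + b) * k0"
    by (simp add: algebra_simps)
  then have "l1 = 0 \<longleftrightarrow> of_real x * (1 - b) * (1 - g) = - b"
    using k0 by (simp add: eq_neg_iff_add_eq_0)
  also have "\<dots> \<longleftrightarrow> \<beta> = \<gamma> \<and> 2 * x * (1 - cos \<gamma>) = 1"
    unfolding b_def g_def by (rule phase_equation_iff[OF assms(9,10)])
  also have "2 * x * (1 - cos \<gamma>) = 1 \<longleftrightarrow>
      real N / 4 \<le> real t \<and> cos \<gamma> = 1 - real N / (2 * real t)"
  \<comment> \<open>For \<open>t = 0\<close> both sides are false: the left reads
    \<open>0 = 1\<close>, and the right fails since \<open>N > 0\<close>, whatever value division by
    zero has.\<close>
  proof (cases "t = 0")
    case False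
    then have "2 * x * (1 - cos \<gamma>) = 1 \<longleftrightarrow> cos \<gamma> = 1 - real N / (2 * real t)"
      using N by (auto simp: x_def field_simps)
    moreover have "real N / 4 \<le> real t" if "cos \<gamma> = 1 - real N / (2 * real t)"
    proof -
      \<comment> \<open>The lower bound on \<open>t\<close> expresses that a cosine is at least
        -1.\<close>
      have "real N / (2 * real t) \<le> 2"
        using that cos_ge_minus_one[of \<gamma>] by linarith
      then show ?thesis
        using False by (simp add: field_simps)
    qed
    ultimately show ?thesis
      by blast
  qed (use N in \<open>simp add: x_def\<close>)
  finally have iff: "l1 = 0 \<longleftrightarrow> real N / 4 \<le> real t \<and> t \<le> N
      \<and> \<beta> = \<gamma> \<and> \<gamma> \<in> cos -` {1 - real N / (2 * real t)}"
    using tN by auto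
  \<comment> \<open>Diffusion shifts all coordinates equally, so it preserves the difference
    \<open>g * k0 - l0\<close> of the two amplitudes.\<close>
  have "k1 = l1 + (g - 1) * k0"
    using N unfolding k1 l1 assms(8)[symmetric] by (simp add: field_simps)
  then have "l1 = 0 \<longrightarrow> k1 = (g - 1) * k0"
    by simp
  moreover have "grover_operator F \<beta> \<gamma> (grover_state F k0 l0) = grover_state F k1 l1"
    using grover_operator_grover_state[OF assms(3), of \<beta> \<gamma> k0 l0] assms(1,2,4,6,7) by simp
  ultimately show ?thesis
    using iff by (simp add: g_def)
qed

end
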